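(* Let $\phi,\psi,\eta\in L^1(\mathbb T)$ and $a\in\mathbb C$, and let $D_k[\phi]\ne0$ for $k=0,1,\dots,n+1$. Then the semi-framed Toeplitz determinants $\mathscr E_{n+2}$, $\mathscr G_{n+2}$, $\mathscr H_{n+2}$, $\mathscr L_{n+2}$ (defined in the context) are encoded into the data of the $X$-Riemann--Hilbert problem (defined in the context) as follows. With $\tilde f(z)=f(z^{-1})$, with $X_{11}$ and $X_{21}$ respectively the $11$ and $21$ entries of the solution to the $X$-Riemann--Hilbert problem, and with $$\Delta(z_1,z_2)=\det\begin{bmatrix} X_{11}(z_2;n+1) & X_{21}(z_2;n+2) \\ X_{11}(z_1;n+1) & X_{21}(z_1;n+2) \end{bmatrix},$$ one has $$\frac{\mathscr E_{n+2}[\phi;\psi,\eta;a]}{D_{n+1}[\phi]}=a-\int_{\mathbb T}\int_{\mathbb T}\frac{z_2^{-n}\eta(z_2)\tilde\psi(z_1)}{z_1-z_2}\Delta(z_1,z_2)\frac{dz_2}{2\pi iz_2}\frac{dz_1}{2\pi iz_1},$$ $$\frac{\mathscr G_{n+2}[\phi;\psi,\eta;a]}{D_{n+1}[\phi]}=a-\int_{\mathbb T}\int_{\mathbb T}\frac{z_1^{-n}\tilde\eta(z_2)\psi(z_1)}{z_1-z_2}\Delta(z_1,z_2)\frac{dz_2}{2\pi iz_2}\frac{dz_1}{2\pi iz_1},$$ $$\frac{\mathscr H_{n+2}[\phi;\psi,\eta;a]}{D_{n+1}[\phi]}=a-\int_{\mathbb T}\int_{\mathbb T}\frac{z_1^{-n}z_2^{-n}\eta(z_2)\psi(z_1)}{z_1-z_2}\Delta(z_1,z_2)\frac{dz_2}{2\pi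 iz_2}\frac{dz_1}{2\pi iz_1},$$ $$\frac{\mathscr L_{n+2}[\phi;\psi,\eta;a]}{D_{n+1}[\phi]}=a-\int_{\mathbb T}\int_{\mathbb T}\frac{\tilde\eta(z_2)\tilde\psi(z_1)}{z_1-z_2}\Delta(z_1,z_2)\frac{dz_2}{2\pi iz_2}\frac{dz_1}{2\pi iz_1}.$$
   Context: $\mathbb T$ is the unit circle oriented counterclockwise. For $f\in L^1(\mathbb T)$, $f_j=\int_{\mathbb T}f(\zeta)\zeta^{-j}\frac{d\zeta}{2\pi i\zeta}$. $D_N[\phi]=\det(\phi_{j-k})_{0\le j,k\le N-1}$, $D_0[\phi]=1$. $X$-Riemann--Hilbert problem with parameter $N$: find $X(\cdot;N):\mathbb C\setminus\mathbb T\to\mathbb C^{2\times2}$ such that (1) $X(\cdot;N)$ is analytic; (2) the limits $X_\pm(z;N)$ from the inside ($+$) and outside ($-$) of the unit circle exist, are continuous on $\mathbb T$, and satisfy $X_+(z;N)=X_-(z;N)\begin{bmatrix} 1 & z^{-N}\phi(z) \\ 0 & 1 \end{bmatrix}$ on $\mathbb T$; (3) as $z\to\infty$, $X(z;N)=\big(I+\overset{\infty}{X}_1(N)z^{-1}+\overset{\infty}{X}_2(N)z^{-2}+O(z^{-3})\big)\,\mathrm{diag}(z^N,z^{-N})$ for some constant matrices $\overset{\infty}{X}_1(N),\overset{\infty}{X}_2(N)$. The first column of $X$ has no jump, so $X_{11},X_{21}$ are entire functions and are well defined on $\mathbb T$. Semi-framed determinants: each of $\mathscr E_N,\mathscr G_N,\mathscr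 H_N,\mathscr L_N[\phi;\psi,\eta;a]$ is the determinant of an $N\times N$ matrix whose upper-left $(N-1)\times(N-1)$ block is $(\phi_{j-k})_{0\le j,k\le N-2}$, whose lower-right entry is $a$, and whose remaining last-column entries (row $j$, $0\le j\le N-2$) and last-row entries (column $k$, $0\le k\le N-2$) are: for $\mathscr E_N$: $\psi_{N-2-j}$ and $\eta_{N-2-k}$; for $\mathscr G_N$: $\psi_j$ and $\eta_k$; for $\mathscr H_N$: $\psi_j$ and $\eta_{N-2-k}$; for $\mathscr L_N$: $\psi_{N-2-j}$ and $\eta_k$. *)

theory Defs
  imports
    "Jordan_Normal_Form.Determinant"
    "HOL-Complex_Analysis.Complex_Analysis"
    "HOL-Library.Landau_Symbols"
begin

no_notation Matrix.vec_index (infixl \<open>$\<close> 100)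

subsection \<open>Functions on the unit circle\<close>

text \<open>
  A function on the circle is represented by a function \<open>complex \<Rightarrow> complex\<close>, of which only the
  values on the circle matter; \<open>circlepath 0 1 t\<close> is \<open>exp (2 * pi * \<i> * t)\<close>, traversed
  counterclockwise for \<open>t\<close> from 0 to 1.
\<close>

definition L1_circle :: "(complex \<Rightarrow> complex) \<Rightarrow> bool" where
  "L1_circle f \<longleftrightarrow> (\<lambda>t. f (circlepath 0 1 t)) absolutely_integrable_on {0..1}"

definition circle_integral :: "(complex \<Rightarrow> complex) \<Rightarrow> complex" where
  "circle_integral f = contour_integral (circlepath 0 1) (\<lambda>z. f z / (2 * pi * \<i> * z))"

definition fourier_coeff :: "(complex \<Rightarrow> complex) \<Rightarrow> int \<Rightarrow> complex" where
  "fourier_coeff f j = circle_integral (\<lambda>z. f z * z powi (- j))"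

definition reflect :: "(complex \<Rightarrow> complex) \<Rightarrow> complex \<Rightarrow> complex" where
  "reflect f z = f (inverse z)"

subsection \<open>Toeplitz and semi-framed Toeplitz determinants\<close>

definition toeplitz_det :: "(complex \<Rightarrow> complex) \<Rightarrow> nat \<Rightarrow> complex" where
  "toeplitz_det \<phi> N =
     Determinant.det (Matrix.mat N N (\<lambda>(j, k). fourier_coeff \<phi> (int j - int k)))"

definition semi_framed_det ::
    "nat \<Rightarrow> (complex \<Rightarrow> complex) \<Rightarrow> (nat \<Rightarrow> complex) \<Rightarrow> (nat \<Rightarrow> complex) \<Rightarrow> complex \<Rightarrow> complex" where
  "semi_framed_det N \<phi> c r a =
     Determinant.det (Matrix.mat N N (\<lambda>(j, k).
       if j < N - 1 \<and> k < N - 1 then fourier_coeff \<phi> (int j - int k)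
       else if j < N - 1 then c j
       else if k < N - 1 then r k
       else a))"

definition E_det ::
    "nat \<Rightarrow> (complex \<Rightarrow> complex) \<Rightarrow> (complex \<Rightarrow> complex) \<Rightarrow> (complex \<Rightarrow> complex) \<Rightarrow> complex \<Rightarrow> complex" where
  "E_det N \<phi> \<psi> \<eta> a = semi_framed_det N \<phi>
     (\<lambda>j. fourier_coeff \<psi> (int N - 2 - int j)) (\<lambda>k. fourier_coeff \<eta> (int N - 2 - int k)) a"

definition G_det ::
    "nat \<Rightarrow> (complex \<Rightarrow> complex) \<Rightarrow> (complex \<Rightarrow> complex) \<Rightarrow> (complex \<Rightarrow> complex) \<Rightarrow> complex \<Rightarrow> complex" where
  "G_det N \<phi> \<psi> \<eta> a = semi_framed_det N \<phi>
     (\<lambda>j. fourier_coeff \<psi> (int j)) (\<lambda>k. fourier_coeff \<eta> (int k)) a"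

definition H_det ::
    "nat \<Rightarrow> (complex \<Rightarrow> complex) \<Rightarrow> (complex \<Rightarrow> complex) \<Rightarrow> (complex \<Rightarrow> complex) \<Rightarrow> complex \<Rightarrow> complex" where
  "H_det N \<phi> \<psi> \<eta> a = semi_framed_det N \<phi>
     (\<lambda>j. fourier_coeff \<psi> (int j)) (\<lambda>k. fourier_coeff \<eta> (int N - 2 - int k)) a"

definition L_det ::
    "nat \<Rightarrow> (complex \<Rightarrow> complex) \<Rightarrow> (complex \<Rightarrow> complex) \<Rightarrow> (complex \<Rightarrow> complex) \<Rightarrow> complex \<Rightarrow> complex" where
  "L_det N \<phi> \<psi> \<eta> a = semi_framed_det N \<phi>
     (\<lambda>j. fourier_coeff \<psi> (int N - 2 - int j)) (\<lambda>k. fourier_coeff \<eta> (int k)) a"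

subsection \<open>The Riemann--Hilbert problem\<close>

definition RHP_jump :: "(complex \<Rightarrow> complex) \<Rightarrow> nat \<Rightarrow> complex \<Rightarrow> complex^2^2" where
  "RHP_jump \<phi> N z = vector [vector [1, z powi (- int N) * \<phi> z], vector [0, 1]]"

text \<open>
  The values \<open>X z\<close> with \<open>z\<close> on the unit circle are irrelevant. Since the symbol \<open>\<phi>\<close> is an element
  of \<open>L\<^sup>1\<close>, the jump relation is imposed almost everywhere; the boundary values themselves exist
  at every point of the circle and are continuous there. The factor \<open>mat c ** A\<close> is the scalar
  multiple of the matrix \<open>A\<close> by \<open>c\<close>.
\<close>

definition X_RHP :: "(complex \<Rightarrow> complex) \<Rightarrow> nat \<Rightarrow> (complex \<Rightarrow> complex^2^2) \<Rightarrow> bool" where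
  "X_RHP \<phi> N X \<longleftrightarrow>
     (\<forall>i j. (\<lambda>z. X z $ i $ j) analytic_on (- sphere 0 1)) \<and>
     (\<exists>Xp Xm.
        (\<forall>z \<in> sphere 0 1. (X \<longlongrightarrow> Xp z) (at z within ball 0 1)) \<and>
        (\<forall>z \<in> sphere 0 1. (X \<longlongrightarrow> Xm z) (at z within - cball 0 1)) \<and>
        continuous_on (sphere 0 1) Xp \<and> continuous_on (sphere 0 1) Xm \<and>
        (AE t in lebesgue_on {0..1}.
           let z = circlepath 0 1 t in Xp z = Xm z ** RHP_jump \<phi> N z)) \<and>
     (\<exists>X1 X2 R.
        (\<forall>\<^sub>F z in at_infinity.
           X z = (Finite_Cartesian_Product.mat 1
                  + Finite_Cartesian_Product.mat (1 / z) ** X1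
                  + Finite_Cartesian_Product.mat (1 / z ^ 2) ** X2 + R z)
                 ** vector [vector [z ^ N, 0], vector [0, z powi (- int N)]]) \<and>
        (\<lambda>z. norm (R z)) \<in> O[at_infinity](\<lambda>z. 1 / norm z ^ 3))"

text \<open>
  The entries of the first column have no jump and extend to entire functions. The value of the
  extension on the circle is the boundary value, taken here from the inside.
\<close>

definition first_column :: "(complex \<Rightarrow> complex^2^2) \<Rightarrow> 2 \<Rightarrow> complex \<Rightarrow> complex" where
  "first_column X i z =
     (if z \<in> sphere 0 1 then Lim (at z within ball 0 1) (\<lambda>w. X w $ i $ 1) else X z $ i $ 1)"

definition Delta ::
    "(complex \<Rightarrow> complex^2^2) \<Rightarrow> (complex \<Rightarrow> complex^2^2) \<Rightarrow> complex \<Rightarrow> complex \<Rightarrow> complex" where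
  "Delta X Y z1 z2 = Determinants.det (vector
     [vector [first_column X 1 z2, first_column Y 2 z2],
      vector [first_column X 1 z1, first_column Y 2 z1]] :: complex^2^2)"

end

theory Submission
  imports Defs
begin

text \<open>
  Comparing the Fourier coefficients of the inner and outer boundary values of \<open>X\<close> shows that
  \<open>X\<^sub>1\<^sub>1(z; n+1) = \<Sum> d\<^sub>k z\<^sup>k\<close> is a monic polynomial of degree \<open>n+1\<close> and \<open>X\<^sub>2\<^sub>1(z; n+2) = \<Sum> c\<^sub>k z\<^sup>k\<close>
  a polynomial of degree at most \<open>n+1\<close>; the jump relation for the second column says that
  \<open>\<Sum>\<^sub>k \<phi>\<^sub>j\<^sub>-\<^sub>k d\<^sub>k = 0\<close> and \<open>\<Sum>\<^sub>k \<phi>\<^sub>j\<^sub>-\<^sub>k c\<^sub>k = - \<delta>\<^sub>j\<^sub>0\<close> for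
  \<open>0 \<le> j \<le> n\<close>. By a Gohberg--Semencul argument the coefficients of the
  Bezoutian \<open>\<Delta>(z\<^sub>1, z\<^sub>2) / (z\<^sub>1 - z\<^sub>2)\<close> are then the entries of the inverse Toeplitz matrix, with one index
  reversed. Integrating against \<open>\<psi>\<close> and \<open>\<eta>\<close> produces the bilinear form in the Schur complement of the
  Toeplitz block of the semi-framed matrix.
\<close>

subsection \<open>Toeplitz inverses and Bezoutians\<close>

text \<open>Reversing the summation order swaps the two arguments of \<open>w\<close>, so the sum
  equals its own negative; in an integral domain of characteristic 0 it must vanish.\<close>

lemma sum_antisymmetric_antidiagonal:
  fixes w :: "nat \<Rightarrow> nat \<Rightarrow> 'a::{idom, ring_char_0}"
  assumes "\<And>j k. w j k = - w k j"
  shows "(\<Sum>s\<le>m. w (l + s) (l + (m - s))) = 0"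
proof -
  have "(\<Sum>s\<le>m. w (l + s) (l + (m - s))) = (\<Sum>s\<le>m. w (l + (m - s)) (l + s))"
    by (rule sum.reindex_bij_witness[of _ "\<lambda>s. m - s" "\<lambda>s. m - s"]) auto
  also have "\<dots> = (\<Sum>s\<le>m. - w (l + s) (l + (m - s)))"
    by (intro sum.cong refl assms)
  also have "\<dots> = - (\<Sum>s\<le>m. w (l + s) (l + (m - s)))"
    by (rule sum_negf)
  finally show ?thesis
    by (simp add: eq_neg_iff_add_eq_0 flip: mult_2)
qed

text \<open>Coefficients of the Bezoutian \<open>(d y * c x - c y * d x) / (x - y)\<close>, the monomial being \<open>x ^ j * y ^ k\<close>.\<close>

definition bezout_coeff :: "(nat \<Rightarrow> 'a::comm_ring_1) \<Rightarrow> (nat \<Rightarrow> 'a) \<Rightarrow> nat \<Rightarrow> nat \<Rightarrow> 'a" where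
  "bezout_coeff c d j k = (\<Sum>s\<le>k. d (k - s) * c (Suc (j + s)) - c (k - s) * d (Suc (j + s)))"

text \<open>This compares the coefficients of \<open>x ^ Suc j * y ^ Suc k\<close> after
  multiplication of the Bezoutian by \<open>x - y\<close>. The next two lemmas treat the monomials
  in which one of the variables is absent.\<close>

lemma bezout_coeff_Suc:
  "bezout_coeff c d j (Suc k) = d (Suc k) * c (Suc j) - c (Suc k) * d (Suc j) + bezout_coeff c d (Suc j) k"
  unfolding bezout_coeff_def by (subst sum.atMost_Suc_shift) simp

lemma bezout_coeff_0_right: "bezout_coeff c d j 0 = d 0 * c (Suc j) - c 0 * d (Suc j)"
  by (simp add: bezout_coeff_def)

text \<open>The left-hand side is the sum of \<open>d k * c j - c k * d j\<close> over a whole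
  antidiagonal, which vanishes by antisymmetry.\<close>

lemma bezout_coeff_0_left:
  fixes c d :: "nat \<Rightarrow> 'a::{idom, ring_char_0}"
  shows "d (Suc k) * c 0 - c (Suc k) * d 0 + bezout_coeff c d 0 k = 0"
proof -
  have "(\<Sum>s\<le>Suc k. d (0 + (Suc k - s)) * c (0 + s) - c (0 + (Suc k - s)) * d (0 + s)) = 0"
    by (rule sum_antisymmetric_antidiagonal[of "\<lambda>j k. d k * c j - c k * d j"]) simp
  then show ?thesis
    by (subst (asm) sum.atMost_Suc_shift) (simp add: bezout_coeff_def)
qed

lemma bezout_coeff_eq_0_left:
  assumes "j \<ge> m" "\<And>k. k > m \<Longrightarrow> c k = 0" "\<And>k. k > m \<Longrightarrow> d k = 0"
  shows "bezout_coeff c d j k = 0"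
  using assms by (auto simp: bezout_coeff_def intro!: sum.neutral)

text \<open>For \<open>j < m\<close> the degree bound leaves only terms in which both indices run
  through \<open>Suc j\<close>, ..., \<open>m\<close>. These form a full antidiagonal of a square
  block, so antisymmetry applies again.\<close>

lemma bezout_coeff_eq_0_right:
  fixes c d :: "nat \<Rightarrow> 'a::{idom, ring_char_0}"
  assumes c: "\<And>k. k > m \<Longrightarrow> c k = 0" and d: "\<And>k. k > m \<Longrightarrow> d k = 0"
  shows "bezout_coeff c d j m = 0"
proof (cases "j < m")
  case True
  define l where "l = Suc j"
  have "bezout_coeff c d j m = (\<Sum>s\<le>m. d (m - s) * c (l + s) - c (m - s) * d (l + s))"
    by (simp add: bezout_coeff_def l_def)
  also have "\<dots> = (\<Sum>s\<le>m - l. d (m - s) * c (l + s) - c (m - s) * d (l + s))"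
  proof (rule sum.mono_neutral_right)
    have "l + s > m" if "s \<in> {..m} - {..m - l}" for s
      using that by auto
    then show "\<forall>s\<in>{..m} - {..m - l}. d (m - s) * c (l + s) - c (m - s) * d (l + s) = 0"
      by (simp add: c d)
  qed auto
  also have "\<dots> = (\<Sum>s\<le>m - l. d (l + (m - l - s)) * c (l + s) - c (l + (m - l - s)) * d (l + s))"
  proof (rule sum.cong)
    have "l + (m - l - s) = m - s" if "s \<in> {..m - l}" for s
      using that True by (simp add: l_def)
    then show "d (m - s) * c (l + s) - c (m - s) * d (l + s) =
        d (l + (m - l - s)) * c (l + s) - c (l + (m - l - s)) * d (l + s)" if "s \<in> {..m - l}" for s
      using that by simp
  qed simp
  also have "\<dots> = 0"
    by (rule sum_antisymmetric_antidiagonal[of "\<lambda>j k. d k * c j - c k * d j"]) simp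
  finally show ?thesis .
qed (auto intro!: bezout_coeff_eq_0_left[of m] simp: c d)

lemma bezoutian_expansion:
  fixes c d :: "nat \<Rightarrow> 'a::{idom, ring_char_0}"
  assumes c: "\<And>k. k > Suc n \<Longrightarrow> c k = 0" and d: "\<And>k. k > Suc n \<Longrightarrow> d k = 0"
  shows "(x - y) * (\<Sum>j\<le>n. \<Sum>k\<le>n. bezout_coeff c d j k * x ^ j * y ^ k) =
    (\<Sum>k\<le>Suc n. d k * y ^ k) * (\<Sum>j\<le>Suc n. c j * x ^ j) -
    (\<Sum>k\<le>Suc n. c k * y ^ k) * (\<Sum>j\<le>Suc n. d j * x ^ j)" 
proof -
  let ?b = "bezout_coeff c d"
  \<comment> \<open>\<open>l\<close> and \<open>r\<close> are the coefficients of the Bezoutian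
    times \<open>x\<close> and times \<open>y\<close>: the same array shifted in one index, with 0
    filled in at the boundary.\<close>
  define l where "l j k = (case j of 0 \<Rightarrow> 0 | Suc i \<Rightarrow> ?b i k)" for j k
  define r where "r j k = (case k of 0 \<Rightarrow> 0 | Suc i \<Rightarrow> ?b j i)" for j k
  \<comment> \<open>The four cases are the two recursions at the edges, the recursion in the
    interior, and the trivial corner \<open>j = k = 0\<close>.\<close>
  have lr: "d k * c j - c k * d j = l j k - r j k" for j k
    by (cases j; cases k)
      (auto simp: l_def r_def bezout_coeff_Suc bezout_coeff_0_right bezout_coeff_0_left[of d _ c] eq_neg_iff_add_eq_0)
  \<comment> \<open>Together with \<open>r_left\<close> this allows both double sums to be extended
    to the common square of indices up to \<open>Suc n\<close>, where they can be subtracted term by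
    term.\<close>
  have l_top: "l j (Suc n) = 0" for j
    using bezout_coeff_eq_0_right[of "Suc n" c d, OF c d] by (simp add: l_def split: nat.split)
  have "x * (\<Sum>j\<le>n. \<Sum>k\<le>n. ?b j k * x ^ j * y ^ k) = (\<Sum>j\<le>n. \<Sum>k\<le>n. l (Suc j) k * x ^ Suc j * y ^ k)"
    by (simp add: sum_distrib_left l_def mult_ac)
  also have "\<dots> = (\<Sum>j\<le>Suc n. \<Sum>k\<le>n. l j k * x ^ j * y ^ k)"
    by (subst sum.atMost_Suc_shift) (simp add: l_def)
  also have "\<dots> = (\<Sum>j\<le>Suc n. \<Sum>k\<le>Suc n. l j k * x ^ j * y ^ k)"
    using l_top by simp
  finally have L: "x * (\<Sum>j\<le>n. \<Sum>k\<le>n. ?b j k * x ^ j * y ^ k) = \<dots>" .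
  have r_left: "r (Suc n) k = 0" for k
    using bezout_coeff_eq_0_left[of "Suc n" "Suc n" c d, OF _ c d] by (simp add: r_def split: nat.split)
  have "y * (\<Sum>j\<le>n. \<Sum>k\<le>n. ?b j k * x ^ j * y ^ k) = (\<Sum>j\<le>n. \<Sum>k\<le>n. r j (Suc k) * x ^ j * y ^ Suc k)"
    by (simp add: sum_distrib_left r_def mult_ac)
  also have "\<dots> = (\<Sum>j\<le>n. \<Sum>k\<le>Suc n. r j k * x ^ j * y ^ k)"
    by (subst sum.atMost_Suc_shift) (simp add: r_def)
  also have "\<dots> = (\<Sum>j\<le>Suc n. \<Sum>k\<le>Suc n. r j k * x ^ j * y ^ k)"
    using r_left by simp
  finally have R: "y * (\<Sum>j\<le>n. \<Sum>k\<le>n. ?b j k * x ^ j * y ^ k) = \<dots>" .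
  have "(x - y) * (\<Sum>j\<le>n. \<Sum>k\<le>n. ?b j k * x ^ j * y ^ k) =
      (\<Sum>j\<le>Suc n. \<Sum>k\<le>Suc n. (l j k - r j k) * x ^ j * y ^ k)"
    unfolding left_diff_distrib L R by (simp add: sum_subtractf)
  also have "\<dots> = (\<Sum>j\<le>Suc n. \<Sum>k\<le>Suc n. (d k * y ^ k) * (c j * x ^ j) - (c k * y ^ k) * (d j * x ^ j))"
    unfolding lr[symmetric] by (intro sum.cong refl) (simp add: algebra_simps)
  also have "\<dots> = (\<Sum>k\<le>Suc n. d k * y ^ k) * (\<Sum>j\<le>Suc n. c j * x ^ j) -
    (\<Sum>k\<le>Suc n. c k * y ^ k) * (\<Sum>j\<le>Suc n. d j * x ^ j)"
    unfolding sum_subtractf sum_product by (subst (1 2) sum.swap) (rule refl)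
  finally show ?thesis .
qed

text \<open>The sums \<open>\<Sum>k. t (i - k) * p j k\<close>, with \<open>p\<close> the Bezoutian coefficients, depend on \<open>i + j\<close>
  only, up to boundary terms that come from the two linear systems.\<close>

lemma bezoutian_toeplitz_inverse:
  fixes c d :: "nat \<Rightarrow> 'a::{idom, ring_char_0}" and t :: "int \<Rightarrow> 'a"
  assumes c: "\<And>k. k > Suc n \<Longrightarrow> c k = 0" and d: "\<And>k. k > Suc n \<Longrightarrow> d k = 0"
    and d_lead: "d (Suc n) = 1"
    and tc: "\<And>i. i \<le> n \<Longrightarrow> (\<Sum>k\<le>Suc n. t (int i - int k) * c k) = (if i = 0 then -1 else 0)"
    and td: "\<And>i. i \<le> n \<Longrightarrow> (\<Sum>k\<le>Suc n. t (int i - int k) * d k) = 0"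
    and "i \<le> n" "j \<le> n"
  shows "(\<Sum>k\<le>n. t (int i - int k) * bezout_coeff c d j k) = (if i + j = n then 1 else 0)"
proof -
  let ?b = "bezout_coeff c d"
  \<comment> \<open>The first argument is an integer because row \<open>-1\<close> occurs below, in
    the step from row 0.\<close>
  define A where "A i j = (\<Sum>k\<le>n. t (i - int k) * ?b j k)" for i j
  have A_eq: "A i j = (\<Sum>k\<le>Suc n. t (i - int k) * ?b j k)" for i j
    using bezout_coeff_eq_0_right[of "Suc n" c d, OF c d] by (simp add: A_def)
  have A_shift: "(\<Sum>k\<le>Suc n. t (i - int k) * (d k * c (Suc j) - c k * d (Suc j))) = A i j - A (i - 1) (Suc j)" for i j
  proof -
    have "A i j = t i * ?b j 0 + (\<Sum>k\<le>n. t (i - 1 - int k) * ?b j (Suc k))"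
      unfolding A_eq by (subst sum.atMost_Suc_shift) (simp add: algebra_simps)
    moreover have "(\<Sum>k\<le>Suc n. t (i - int k) * (d k * c (Suc j) - c k * d (Suc j))) =
        t i * ?b j 0 + (\<Sum>k\<le>n. t (i - 1 - int k) * (d (Suc k) * c (Suc j) - c (Suc k) * d (Suc j)))"
      by (subst sum.atMost_Suc_shift) (simp add: bezout_coeff_0_right algebra_simps)
    ultimately show ?thesis
      by (simp add: bezout_coeff_Suc A_def distrib_left sum.distrib)
  qed
  \<comment> \<open>Kept for arbitrary \<open>x\<close> and \<open>y\<close>, since it is applied
    both to \<open>c (Suc j)\<close>, \<open>d (Suc j)\<close> and to \<open>c 0\<close>,
    \<open>d 0\<close>. The entry -1 in the system for \<open>c\<close> produces the only nonzero
    value.\<close>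
  have lhs: "(\<Sum>k\<le>Suc n. t (int i - int k) * (d k * x - c k * y)) = (if i = 0 then y else 0)"
    if "i \<le> n" for i x y
  proof -
    have "(\<Sum>k\<le>Suc n. t (int i - int k) * (d k * x - c k * y)) =
      (\<Sum>k\<le>Suc n. t (int i - int k) * d k) * x - (\<Sum>k\<le>Suc n. t (int i - int k) * c k) * y"
      unfolding sum_distrib_right sum_subtractf[symmetric]
      by (intro sum.cong refl) (simp add: algebra_simps)
    then show ?thesis
      by (simp add: td[OF that] tc[OF that] del: sum.atMost_Suc)
  qed
  have step: "A (int i) j - A (int i - 1) (Suc j) = (if i = 0 then d (Suc j) else 0)" if "i \<le> n" for i j
    using A_shift[of "int i" j] lhs[OF that] by simp
  \<comment> \<open>The Bezoutian coefficients vanish for first index \<open>Suc n\<close>, and the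
    boundary term in row 0 is the leading coefficient \<open>d (Suc n) = 1\<close>. This is where
    the 1 of the inverse comes from.\<close>
  have top: "A (int i) n = (if i = 0 then 1 else 0)" if "i \<le> n" for i
  proof -
    have "A (int i - 1) (Suc n) = 0"
      using bezout_coeff_eq_0_left[of "Suc n" "Suc n" c d, OF _ c d] by (simp add: A_def)
    then show ?thesis
      using step[OF that, of n] d_lead by simp
  qed
  \<comment> \<open>By \<open>bezout_coeff_0_left\<close> this sum is minus row \<open>Suc i\<close>
    of the combined system; the term \<open>k = 0\<close> that has to be added is
    \<open>d 0 * c 0 - c 0 * d 0 = 0\<close>.\<close>
  have bottom: "A (int i) 0 = 0" if "Suc i \<le> n" for i
  proof -
    have "A (int i) 0 = (\<Sum>k\<le>n. t (int (Suc i) - int (Suc k)) * (- (d (Suc k) * c 0 - c (Suc k) * d 0)))"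
      unfolding A_def minus_unique[OF bezout_coeff_0_left] by simp
    also have "\<dots> = - (\<Sum>k\<le>Suc n. t (int (Suc i) - int k) * (d k * c 0 - c k * d 0))"
      by (simp add: sum.atMost_Suc_shift sum_subtractf algebra_simps del: sum.atMost_Suc)
    also have "\<dots> = 0"
      using lhs[OF that, of "c 0" "d 0"] by simp
    finally show ?thesis .
  qed
  \<comment> \<open>Away from row 0 the boundary term in \<open>step\<close> is absent, so
    \<open>A\<close> is constant along antidiagonals.\<close>
  have down: "A (int i) j = A (int (i - m)) (j + m)" if "m \<le> i" "i \<le> n" for i j m
    using that
  proof (induction m)
    case (Suc m)
    then have "A (int i) j = A (int (i - m)) (j + m)"
      by simp
    also have "\<dots> = A (int (i - m) - 1) (Suc (j + m))"
      using step[of "i - m" "j + m"] Suc.prems by simp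
    also have "int (i - m) - 1 = int (i - Suc m)"
      using Suc.prems by simp
    finally show ?case
      by simp
  qed simp
  \<comment> \<open>Follow the antidiagonal to an edge: below the main antidiagonal sum
    \<open>n\<close> it ends in column 0, where \<open>bottom\<close> gives 0; otherwise it ends in
    column \<open>n\<close>, in row 0 exactly when \<open>i + j = n\<close>.\<close>
  show ?thesis
  proof (cases "i + j < n")
    case True
    then have "A (int i) j = A (int (i + j)) 0"
      using down[of j "i + j" 0] by simp
    then show ?thesis
      using True bottom[of "i + j"] by (simp add: A_def)
  next
    case False
    then have "A (int i) j = A (int (i - (n - j))) n"
      using down[of "n - j" i j] \<open>i \<le> n\<close> \<open>j \<le> n\<close> by simp
    then show ?thesis
      using False top[of "i - (n - j)"] \<open>i \<le> n\<close> \<open>j \<le> n\<close> by (auto simp: A_def)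
  qed
qed

subsection \<open>Integration and Fourier coefficients on the circle\<close>

lemma circlepath_in_sphere: "circlepath 0 1 t \<in> sphere 0 1"
  by (simp add: circlepath)

lemma continuous_on_circlepath_compose:
  assumes "continuous_on (sphere 0 1) g"
  shows "continuous_on {0..1} (\<lambda>t. g (circlepath 0 1 t))"
proof (rule continuous_on_compose2[OF assms])
  show "continuous_on {0..1} (circlepath 0 (1::real))"
    using path_circlepath unfolding path_def by blast
qed (use circlepath_in_sphere in blast)

text \<open>The derivative of \<open>exp (2 * pi * \<i> * t)\<close> cancels the factor
  \<open>2 * pi * \<i> * z\<close>, so the normalised contour integral is the plain integral in the
  parameter.\<close>

lemma circle_integral_eq_integral:
  "circle_integral f = integral {0..1} (\<lambda>t. f (circlepath 0 1 t))"
proof -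
  have "f (circlepath 0 1 t) / (2 * pi * \<i> * circlepath 0 1 t) *
          vector_derivative (circlepath 0 1) (at t) = f (circlepath 0 1 t)" for t
    unfolding vector_derivative_circlepath by (simp add: circlepath)
  then show ?thesis
    by (simp add: circle_integral_def contour_integral_integral)
qed

lemma circle_integral_cong:
  assumes "\<And>z. z \<in> sphere 0 1 \<Longrightarrow> f z = g z"
  shows "circle_integral f = circle_integral g"
  unfolding circle_integral_eq_integral
  by (intro integral_cong assms circlepath_in_sphere)

lemma circle_integral_cong_AE:
  assumes "AE t in lebesgue_on {0..1}. f (circlepath 0 1 t) = g (circlepath 0 1 t)"
  shows "circle_integral f = circle_integral g"
proof -
  have "AE t in lebesgue. t \<in> {0..1} \<longrightarrow> f (circlepath 0 1 t) = g (circlepath 0 1 t)"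
    using assms by (subst (asm) AE_restrict_space_iff) auto
  then obtain S where "S \<in> null_sets lebesgue"
    and S: "{t. \<not> (t \<in> {0..1} \<longrightarrow> f (circlepath 0 1 t) = g (circlepath 0 1 t))} \<subseteq> S"
    unfolding eventually_ae_filter by auto
  then have "negligible S"
    by (simp add: negligible_iff_null_sets)
  then show ?thesis
    unfolding circle_integral_eq_integral
    by (rule integral_spike) (use S in auto)
qed

text \<open>The parametrisation meets a point at most once apart from its endpoints, so the
  exceptional parameters form a finite set. This disposes of the diagonal of the kernel, where the
  quotient by \<open>z1 - z2\<close> has the default value 0.\<close>

lemma circle_integral_cong_except:
  assumes "\<And>z. z \<in> sphere 0 1 \<Longrightarrow> z \<noteq> w \<Longrightarrow> f z = g z"
  shows "circle_integral f = circle_integral g"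
proof -
  have "loop_free (circlepath 0 1 :: real \<Rightarrow> complex)"
    using simple_path_circlepath[of "0::complex" 1] by (simp add: simple_path_def)
  then have "\<exists>x. {t \<in> {0..1}. circlepath 0 1 t = w} \<subseteq> {x, 0, 1}"
  proof (cases "\<exists>x \<in> {0..1}. circlepath 0 1 x = w")
    case True
    then obtain x where "x \<in> {0..1}" "circlepath 0 1 x = w"
      by blast
    then have "{t \<in> {0..1}. circlepath 0 1 t = w} \<subseteq> {x, 0, 1}"
      using \<open>loop_free (circlepath 0 1)\<close> unfolding loop_free_def by fastforce
    then show ?thesis ..
  qed blast
  then have "negligible {t \<in> {0..1}. circlepath 0 1 t = w}"
    by (meson finite.emptyI finite_insert negligible_finite negligible_subset)
  then show ?thesis
    unfolding circle_integral_eq_integral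
    by (rule integral_spike) (use assms circlepath_in_sphere in auto)
qed

lemma L1_circle_mult_continuous:
  assumes "L1_circle f" "continuous_on (sphere 0 1) g"
  shows "L1_circle (\<lambda>z. g z * f z)"
proof -
  note cont = continuous_on_circlepath_compose[OF assms(2)]
  have "compact ((\<lambda>t. g (circlepath 0 1 t)) ` {0..1})"
    by (rule compact_continuous_image[OF cont]) auto
  then have "bounded ((\<lambda>t. g (circlepath 0 1 t)) ` {0..1})"
    by (rule compact_imp_bounded)
  moreover have "(\<lambda>t. g (circlepath 0 1 t)) \<in> borel_measurable (lebesgue_on {0..1})"
    by (rule continuous_imp_measurable_on_sets_lebesgue[OF cont]) auto
  moreover have "bilinear ((*) :: complex \<Rightarrow> _)"
    by (simp add: bilinear_conv_bounded_bilinear bounded_bilinear_mult)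
  ultimately show ?thesis
    unfolding L1_circle_def
    by (intro absolutely_integrable_bounded_measurable_product[where h = "(*)"])
      (use assms(1) in \<open>simp_all add: L1_circle_def\<close>)
qed

lemma L1_circle_continuous:
  assumes "continuous_on (sphere 0 1) g"
  shows "L1_circle g"
  unfolding L1_circle_def
  by (rule absolutely_integrable_continuous_real[OF continuous_on_circlepath_compose[OF assms]])

lemma L1_circle_imp_integrable:
  "L1_circle f \<Longrightarrow> (\<lambda>t. f (circlepath 0 1 t)) integrable_on {0..1}"
  unfolding L1_circle_def by (rule set_lebesgue_integral_eq_integral(1))

lemma circle_integral_sum:
  assumes "finite I" "\<And>i. i \<in> I \<Longrightarrow> L1_circle (f i)"
  shows "circle_integral (\<lambda>z. \<Sum>i\<in>I. f i z) = (\<Sum>i\<in>I. circle_integral (f i))"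
  unfolding circle_integral_eq_integral
  using assms by (intro integral_sum L1_circle_imp_integrable)

lemma circle_integral_diff:
  assumes "L1_circle f" "L1_circle g"
  shows "circle_integral (\<lambda>z. f z - g z) = circle_integral f - circle_integral g"
  unfolding circle_integral_eq_integral
  using assms by (intro integral_diff L1_circle_imp_integrable)

lemma circle_integral_mult_left:
  "circle_integral (\<lambda>z. c * f z) = c * circle_integral f"
  unfolding circle_integral_eq_integral by simp

section \<open>Inversion of the circle and rules for Fourier coefficients\<close>

lemma circlepath_one_minus: "circlepath 0 1 (1 - t) = inverse (circlepath 0 1 t)"
proof -
  have "2 * of_real pi * \<i> * of_real (1 - t) = 2 * of_real pi * \<i> - 2 * of_real pi * \<i> * of_real t"
    by (simp add: algebra_simps)
  then show ?thesis
    by (simp add: circlepath exp_diff inverse_eq_divide del: of_real_diff)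
qed

lemma has_integral_reflect_unit_interval:
  fixes f :: "real \<Rightarrow> 'b::euclidean_space"
  assumes "(f has_integral I) {0..1}"
  shows "((\<lambda>t. f (1 - t)) has_integral I) {0..1}"
proof -
  have "((\<lambda>t. f (- t)) has_integral I) {-1..-0}"
    using assms by (subst has_integral_reflect_real)
  from has_integral_shift_real_ivl[OF this, of "-1"] show ?thesis
    by simp
qed

lemma L1_circle_reflect:
  assumes "L1_circle f"
  shows "L1_circle (reflect f)"
proof -
  have "(\<lambda>t. f (circlepath 0 1 (1 - t))) absolutely_integrable_on {0..1}"
    using assms
      has_integral_reflect_unit_interval[of "\<lambda>t. f (circlepath 0 1 t)"]
      has_integral_reflect_unit_interval[of "\<lambda>t. norm (f (circlepath 0 1 t))"]
    unfolding L1_circle_def absolutely_integrable_on_def integrable_on_def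
    by auto
  then show ?thesis
    by (simp add: L1_circle_def reflect_def circlepath_one_minus)
qed

lemma circle_integral_reflect:
  assumes "L1_circle f"
  shows "circle_integral (reflect f) = circle_integral f"
proof -
  have "((\<lambda>t. f (circlepath 0 1 (1 - t))) has_integral circle_integral f) {0..1}"
    using L1_circle_imp_integrable[OF assms]
    unfolding circle_integral_eq_integral
    by (intro has_integral_reflect_unit_interval) (rule integrable_integral)
  then show ?thesis
    unfolding circle_integral_eq_integral[of "reflect f"] reflect_def circlepath_one_minus
    by (rule integral_unique)
qed

lemma L1_circle_power:
  assumes "L1_circle f"
  shows "L1_circle (\<lambda>z. z powi k * f z)"
  by (rule L1_circle_mult_continuous[OF assms]) (intro continuous_intros, auto)

lemma fourier_coeff_reflect:
  assumes "L1_circle f"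
  shows "fourier_coeff (reflect f) j = fourier_coeff f (- j)"
proof -
  have "reflect (\<lambda>z. z powi j * f z) = (\<lambda>z. reflect f z * z powi (- j))"
    by (simp add: fun_eq_iff reflect_def power_int_minus power_int_inverse)
  moreover have "circle_integral (reflect (\<lambda>z. z powi j * f z)) = circle_integral (\<lambda>z. z powi j * f z)"
    by (intro circle_integral_reflect L1_circle_power assms)
  ultimately show ?thesis
    by (simp add: fourier_coeff_def mult.commute)
qed

lemma fourier_coeff_shift: "fourier_coeff (\<lambda>z. z powi k * f z) j = fourier_coeff f (j - k)"
  unfolding fourier_coeff_def
proof (rule circle_integral_cong)
  fix z :: complex assume "z \<in> sphere 0 1"
  then have "z \<noteq> 0"
    by auto
  then show "z powi k * f z * z powi - j = f z * z powi - (j - k)"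
    using power_int_add[of z k "- j"] by simp
qed

lemma fourier_coeff_sum:
  assumes "finite I" "\<And>i. i \<in> I \<Longrightarrow> L1_circle (f i)"
  shows "fourier_coeff (\<lambda>z. \<Sum>i\<in>I. c i * f i z) j = (\<Sum>i\<in>I. c i * fourier_coeff (f i) j)"
proof -
  have *: "L1_circle (\<lambda>z. (c i * z powi (-j)) * f i z)" if "i \<in> I" for i
    by (rule L1_circle_mult_continuous[OF assms(2)[OF that]]) (intro continuous_intros, auto)
  have "fourier_coeff (\<lambda>z. \<Sum>i\<in>I. c i * f i z) j =
        circle_integral (\<lambda>z. \<Sum>i\<in>I. (c i * z powi (-j)) * f i z)"
    by (simp add: fourier_coeff_def sum_distrib_left sum_distrib_right mult_ac)
  also have "\<dots> = (\<Sum>i\<in>I. circle_integral (\<lambda>z. c i * (f i z * z powi (-j))))"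
    by (subst circle_integral_sum[OF assms(1) *]) (auto simp: mult_ac)
  finally show ?thesis
    by (simp add: circle_integral_mult_left fourier_coeff_def)
qed

lemma fourier_coeff_sum_powers:
  assumes "L1_circle f"
  shows "fourier_coeff (\<lambda>z. \<Sum>k\<le>n. c k * (z powi int k * f z)) j =
      (\<Sum>k\<le>n. c k * fourier_coeff f (j - int k))"
  unfolding fourier_coeff_shift[symmetric]
  by (intro fourier_coeff_sum L1_circle_power assms) simp

lemma circle_integral_sum_powers:
  assumes "L1_circle f"
  shows "circle_integral (\<lambda>z. \<Sum>k\<le>n. c k * (z powi int k * f z)) =
      (\<Sum>k\<le>n. c k * fourier_coeff f (- int k))"
  using fourier_coeff_sum_powers[OF assms, where n = n and c = c and j = 0] by (simp add: fourier_coeff_def[of _ 0])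

lemma fourier_coeff_cong_AE:
  assumes "AE t in lebesgue_on {0..1}. f (circlepath 0 1 t) = g (circlepath 0 1 t)"
  shows "fourier_coeff f j = fourier_coeff g j"
  unfolding fourier_coeff_def
  by (rule circle_integral_cong_AE) (use assms in eventually_elim, simp)

lemma fourier_coeff_diff:
  assumes "L1_circle f" "L1_circle g"
  shows "fourier_coeff (\<lambda>z. f z - g z) j = fourier_coeff f j - fourier_coeff g j"
  using circle_integral_diff[OF assms[THEN L1_circle_power[where k = "- j"]]]
  by (simp add: fourier_coeff_def algebra_simps)

subsection \<open>Fourier coefficients of boundary values\<close>

text \<open>Cauchy's formula for higher derivatives, valid on the boundary circle itself because
  \<open>f\<close> is continuous up to it.\<close>

lemma fourier_coeff_disc:
  assumes "continuous_on (cball 0 1) f" "f holomorphic_on ball 0 1"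
  shows "fourier_coeff f (int k) = (deriv ^^ k) f 0 / fact k"
proof -
  have "((\<lambda>u. f u / (u - 0) ^ Suc k) has_contour_integral
          (2 * pi * \<i> / fact k * (deriv ^^ k) f 0)) (circlepath 0 1)"
    by (rule Cauchy_has_contour_integral_higher_derivative_circlepath[OF assms]) simp
  from has_contour_integral_div[OF this, of "2 * pi * \<i>"]
  have "contour_integral (circlepath 0 1) (\<lambda>u. f u / u ^ Suc k / (2 * pi * \<i>)) =
        2 * pi * \<i> / fact k * (deriv ^^ k) f 0 / (2 * pi * \<i>)"
    by (intro contour_integral_unique) simp
  then show ?thesis
    by (simp add: fourier_coeff_def circle_integral_def power_int_minus field_simps)
qed

text \<open>Multiplication by a positive power of \<open>z\<close> turns the coefficient into the
  value at 0 of a function that vanishes there.\<close>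

lemma fourier_coeff_disc_negative:
  assumes "continuous_on (cball 0 1) f" "f holomorphic_on ball 0 1" "j < 0"
  shows "fourier_coeff f j = 0"
proof -
  obtain k where j: "j = - int (Suc k)"
    using \<open>j < 0\<close> by (metis negD)
  have "fourier_coeff (\<lambda>z. z powi int (Suc k) * f z) (int 0) =
        (deriv ^^ 0) (\<lambda>z. z powi int (Suc k) * f z) 0 / fact 0"
    unfolding power_int_of_nat
    by (rule fourier_coeff_disc; intro continuous_intros holomorphic_intros assms)
  then show ?thesis
    unfolding fourier_coeff_shift j by simp
qed

text \<open>In the open disc the power series terminates, and continuity carries the identity over
  to the boundary.\<close>

lemma disc_function_eq_polynomial:
  assumes cont: "continuous_on (cball 0 1) f" and hol: "f holomorphic_on ball 0 1"
    and zero: "\<And>k. k > N \<Longrightarrow> fourier_coeff f (int k) = 0" and z: "z \<in> cball 0 1"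
  shows "f z = (\<Sum>k\<le>N. fourier_coeff f (int k) * z ^ k)"
proof -
  have closure: "closure (ball 0 1) = cball (0::complex) 1"
    by (rule closure_ball) simp
  have eq: "f w - (\<Sum>k\<le>N. fourier_coeff f (int k) * w ^ k) = 0" if "w \<in> ball 0 1" for w
  proof -
    have "(\<lambda>k. fourier_coeff f (int k) * w ^ k) sums f w"
      using holomorphic_power_series[OF hol that]
      by (simp add: fourier_coeff_disc[OF cont hol])
    moreover have "(\<lambda>k. fourier_coeff f (int k) * w ^ k) sums
        (\<Sum>k\<le>N. fourier_coeff f (int k) * w ^ k)"
      by (rule sums_finite) (auto simp: zero)
    ultimately show ?thesis
      by (simp add: sums_unique2)
  qed
  have "continuous_on (closure (ball 0 1))
      (\<lambda>w. f w - (\<Sum>k\<le>N. fourier_coeff f (int k) * w ^ k))"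
    unfolding closure by (intro continuous_intros cont)
  moreover note eq
  moreover have "z \<in> closure (ball 0 1)"
    using z closure by simp
  ultimately have "f z - (\<Sum>k\<le>N. fourier_coeff f (int k) * z ^ k) = 0"
    by (rule continuous_constant_on_closure)
  then show ?thesis
    by simp
qed

text \<open>At a boundary point, approach within the closed ball splits into approach through the
  open ball, governed by \<open>lim\<close>, and along the sphere, governed by the continuity of
  \<open>b\<close>.\<close>

lemma continuous_on_cball_boundary_values:
  fixes f b :: "'a::real_normed_vector \<Rightarrow> 'b::topological_space"
  assumes f: "continuous_on (ball x r) f" and b: "continuous_on (sphere x r) b"
    and lim: "\<And>z. z \<in> sphere x r \<Longrightarrow> (f \<longlongrightarrow> b z) (at z within ball x r)"
  shows "continuous_on (cball x r) (\<lambda>z. if z \<in> ball x r then f z else b z)" (is "continuous_on _ ?g")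
  unfolding continuous_on_def
proof
  fix z assume "z \<in> cball x r"
  then consider "z \<in> ball x r" | "z \<in> sphere x r"
    by force
  then show "(?g \<longlongrightarrow> ?g z) (at z within cball x r)"
  proof cases
    case 1
    have "continuous_on (ball x r) ?g"
      by (rule continuous_on_eq[OF f]) simp
    then have "isCont ?g z"
      using 1 continuous_on_eq_continuous_at by blast
    then show ?thesis
      unfolding isCont_def by (rule tendsto_within_subset) simp
  next
    case 2
    have "(?g \<longlongrightarrow> b z) (at z within ball x r)"
      by (rule Lim_transform_eventually[OF lim[OF 2]]) (auto simp: eventually_at_filter)
    moreover have "(b \<longlongrightarrow> b z) (at z within sphere x r)"
      using b 2 by (simp add: continuous_on_def)
    then have "(?g \<longlongrightarrow> b z) (at z within sphere x r)"
      by (rule Lim_transform_eventually) (auto simp: eventually_at_filter)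
    moreover have "cball x r = ball x r \<union> sphere x r"
      by force
    ultimately show ?thesis
      using 2 by (simp add: at_within_union filterlim_sup)
  qed
qed

text \<open>The substitution \<open>z = inverse u\<close> moves infinity to 0, and the limit
  \<open>L\<close> makes the singularity there removable.\<close>

lemma holomorphic_inversion_removable:
  assumes hol: "f holomorphic_on (- cball 0 1)"
    and lim: "((\<lambda>z. z powi m * f z) \<longlongrightarrow> L) at_infinity"
  shows "(\<lambda>u. if u = 0 then L else inverse u powi m * f (inverse u)) holomorphic_on ball 0 1"
    (is "?g holomorphic_on _")
proof (rule no_isolated_singularity'[where K = "{0}"])
  have "((\<lambda>u. inverse u powi m * f (inverse u)) \<longlongrightarrow> L) (at 0 within ball 0 1)"
    using lim unfolding lim_at_infinity_0 o_def by (rule tendsto_within_subset) simp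
  then have "(?g \<longlongrightarrow> L) (at 0 within ball 0 1)"
    by (rule Lim_transform_eventually) (auto simp: eventually_at_filter)
  then show "(?g \<longlongrightarrow> ?g z) (at z within ball 0 1)" if "z \<in> {0}" for z
    using that by simp
  have "(\<lambda>u. inverse u powi m * f (inverse u)) holomorphic_on ball 0 1 - {0}"
    by (intro holomorphic_intros holomorphic_on_compose_gen[OF _ hol, unfolded o_def])
      (auto simp: norm_inverse inverse_le_1_iff)
  then show "?g holomorphic_on ball 0 1 - {0}"
    by (rule holomorphic_transform) simp
qed auto

text \<open>After inversion and multiplication by a power, \<open>f\<close> becomes a function on
  the disc with value \<open>L\<close> at 0. Its coefficient of index \<open>k\<close> is the
  coefficient of \<open>b\<close> of index \<open>- k - m\<close>, so index 0 gives \<open>L\<close>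
  and negative indices give 0.\<close>

lemma fourier_coeff_exterior:
  assumes hol: "f holomorphic_on (- cball 0 1)"
    and cont: "continuous_on (sphere 0 1) b"
    and bd: "\<And>z. z \<in> sphere 0 1 \<Longrightarrow> (f \<longlongrightarrow> b z) (at z within - cball 0 1)"
    and lim: "((\<lambda>z. z powi m * f z) \<longlongrightarrow> L) at_infinity"
  shows "fourier_coeff b (- m) = L" and "j > - m \<Longrightarrow> fourier_coeff b j = 0"
proof -
  define g where "g u = (if u = 0 then L else inverse u powi m * f (inverse u))" for u
  define h where "h u = (if u \<in> ball 0 1 then g u else inverse u powi m * b (inverse u))" for u
  have hol_g: "g holomorphic_on ball 0 1"
    unfolding g_def by (rule holomorphic_inversion_removable[OF hol lim])
  have hol_h: "h holomorphic_on ball 0 1"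
    by (rule holomorphic_transform[OF hol_g]) (simp add: h_def)
  have "(g \<longlongrightarrow> inverse z powi m * b (inverse z)) (at z within ball 0 1)" if z: "z \<in> sphere 0 1" for z
  proof -
    have "z \<noteq> 0"
      using z by auto
    \<comment> \<open>Approach to \<open>z\<close> from inside becomes approach to
      \<open>inverse z\<close> from outside, which \<open>bd\<close> controls.\<close>
    have "filterlim inverse (at (inverse z) within - cball 0 1) (at z within ball 0 1)"
    proof (rule filterlim_at_withinI)
      show "(inverse \<longlongrightarrow> inverse z) (at z within ball 0 1)"
        using \<open>z \<noteq> 0\<close> by (intro tendsto_intros)
      have "\<forall>\<^sub>F u in at z within ball 0 1. u \<in> ball 0 1 \<and> u \<noteq> 0"
        by (intro eventually_conj eventually_neq_at_within) (auto simp: eventually_at_filter)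
      then show "\<forall>\<^sub>F u in at z within ball 0 1. inverse u \<in> - cball 0 1 - {inverse z}"
        by eventually_elim (use z in \<open>auto simp: norm_inverse one_less_inverse not_le\<close>)
    qed
    then have "((\<lambda>u. f (inverse u)) \<longlongrightarrow> b (inverse z)) (at z within ball 0 1)"
      using z by (intro filterlim_compose[OF bd]) (auto simp: norm_inverse)
    then have "((\<lambda>u. inverse u powi m * f (inverse u)) \<longlongrightarrow> inverse z powi m * b (inverse z))
        (at z within ball 0 1)"
      using \<open>z \<noteq> 0\<close> by (intro tendsto_intros) auto
    moreover have "\<forall>\<^sub>F u in at z within ball 0 1. u \<noteq> 0"
      by (rule eventually_neq_at_within)
    ultimately show ?thesis
      by (rule Lim_transform_eventually[OF _ eventually_mono]) (simp add: g_def)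
  qed
  moreover have "continuous_on (sphere 0 1) (\<lambda>u. inverse u powi m * b (inverse u))"
    by (intro continuous_intros continuous_on_compose2[OF cont]) (auto simp: norm_inverse)
  ultimately have cont_h: "continuous_on (cball 0 1) h"
    unfolding h_def
    by (intro continuous_on_cball_boundary_values holomorphic_on_imp_continuous_on[OF hol_g])
  have "fourier_coeff h k = fourier_coeff b (- k - m)" for k
  proof -
    have "fourier_coeff h k = fourier_coeff (\<lambda>u. u powi (- m) * reflect b u) k"
      unfolding fourier_coeff_def
      by (rule circle_integral_cong)
        (auto simp: h_def g_def reflect_def power_int_minus power_int_inverse)
    also have "\<dots> = fourier_coeff b (- k - m)"
      by (simp add: fourier_coeff_shift fourier_coeff_reflect L1_circle_continuous[OF cont])
    finally show ?thesis .
  qed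
  note shift = this
  show "fourier_coeff b (- m) = L"
    using fourier_coeff_disc[OF cont_h hol_h, of 0] shift[of 0] by (simp add: h_def g_def)
  show "fourier_coeff b j = 0" if "j > - m"
    using fourier_coeff_disc_negative[OF cont_h hol_h, of "- j - m"] shift[of "- j - m"] that by simp
qed

subsection \<open>The Riemann--Hilbert data\<close>

lemma cmod_matrix_entry_le: "norm (M $ i $ j) \<le> norm (M :: complex^'n^'m)"
  by (meson Finite_Cartesian_Product.norm_nth_le order_trans)

lemma tendsto_bigo_inverse_cube:
  fixes R :: "complex \<Rightarrow> complex^'n^'m"
  assumes "(\<lambda>z. norm (R z)) \<in> O[at_infinity](\<lambda>z. 1 / norm z ^ 3)"
  shows "((\<lambda>z. z * R z $ i $ j) \<longlongrightarrow> 0) at_infinity" 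
proof -
  obtain C where C: "\<forall>\<^sub>F z in at_infinity. norm (norm (R z)) \<le> C * norm (1 / norm z ^ 3)"
    using assms by (elim landau_o.bigE)
  have *: "((\<lambda>z::complex. C * norm (inverse z) ^ 2) \<longlongrightarrow> C * norm (0::complex) ^ 2) at_infinity"
    by (intro tendsto_intros tendsto_inverse_0)
  show ?thesis
  proof (rule Lim_null_comparison)
    show "((\<lambda>z::complex. C * norm (inverse z) ^ 2) \<longlongrightarrow> 0) at_infinity"
      using * by simp
    show "\<forall>\<^sub>F z in at_infinity. norm (z * R z $ i $ j) \<le> C * norm (inverse z) ^ 2"
      using C eventually_not_equal_at_infinity[of 0]
    proof eventually_elim
      case (elim z)
      have "norm (z * R z $ i $ j) \<le> norm z * norm (R z)"
        by (simp add: norm_mult mult_left_mono cmod_matrix_entry_le)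
      also have "\<dots> \<le> norm z * (C * (1 / norm z ^ 3))"
        using elim by (intro mult_left_mono) auto
      also have "\<dots> = C * norm (inverse z) ^ 2"
        using elim by (simp add: norm_divide field_simps power2_eq_square power3_eq_cube)
      finally show ?case .
    qed
  qed
qed

text \<open>These limits bound the degrees of the first column and normalise the two linear systems:
  the diagonal entries have leading coefficient 1, while the off-diagonal ones lose one power of
  \<open>z\<close>.\<close>

lemma X_RHP_asymptotics:
  fixes X :: "complex \<Rightarrow> complex^2^2"
  assumes "X_RHP \<phi> N X"
  shows "((\<lambda>z. z powi (- int N) * X z $ 1 $ 1) \<longlongrightarrow> 1) at_infinity"
    and "\<exists>L. ((\<lambda>z. z powi (1 - int N) * X z $ 2 $ 1) \<longlongrightarrow> L) at_infinity"
    and "\<exists>L. ((\<lambda>z. z powi (1 + int N) * X z $ 1 $ 2) \<longlongrightarrow> L) at_infinity"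
    and "((\<lambda>z. z powi int N * X z $ 2 $ 2) \<longlongrightarrow> 1) at_infinity"
proof -
  obtain X1 X2 R where
    X: "\<forall>\<^sub>F z in at_infinity.
           X z = (Finite_Cartesian_Product.mat 1
                  + Finite_Cartesian_Product.mat (1 / z) ** X1
                  + Finite_Cartesian_Product.mat (1 / z ^ 2) ** X2 + R z)
                 ** vector [vector [z ^ N, 0], vector [0, z powi (- int N)]]"
    and R: "(\<lambda>z. norm (R z)) \<in> O[at_infinity](\<lambda>z. 1 / norm z ^ 3)"
    using assms unfolding X_RHP_def by blast
  \<comment> \<open>Near infinity, \<open>X\<close> is the identity plus \<open>inverse z\<close>
    times the matrix with entries \<open>E i j z\<close>, multiplied by the diagonal matrix of
    powers.\<close>
  define E where "E i j z = X1 $ i $ j + X2 $ i $ j * inverse z + z * R z $ i $ j" for i j z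
  have E: "(E i j \<longlongrightarrow> X1 $ i $ j) at_infinity" for i j
  proof -
    have "(E i j \<longlongrightarrow> X1 $ i $ j + X2 $ i $ j * 0 + 0) at_infinity"
      unfolding E_def by (intro tendsto_intros tendsto_inverse_0 tendsto_bigo_inverse_cube[OF R])
    then show ?thesis
      by simp
  qed
  have E_inverse: "((\<lambda>z. 1 + inverse z * E i j z) \<longlongrightarrow> 1) at_infinity" for i j
    using tendsto_add[OF tendsto_const[of 1] tendsto_mult[OF tendsto_inverse_0 E]] by simp
  have entries: "\<forall>\<^sub>F z in at_infinity. z \<noteq> 0 \<and>
      X z $ 1 $ 1 = (1 + inverse z * E 1 1 z) * z ^ N \<and>
      X z $ 2 $ 1 = inverse z * E 2 1 z * z ^ N \<and>
      X z $ 1 $ 2 = inverse z * E 1 2 z * z powi (- int N) \<and>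
      X z $ 2 $ 2 = (1 + inverse z * E 2 2 z) * z powi (- int N)"
    using X eventually_not_equal_at_infinity[of 0]
  proof eventually_elim
    case (elim z)
    then show ?case
      by (simp add: matrix_matrix_mult_def sum_2 vector_2 Finite_Cartesian_Product.mat_def E_def)
         (simp add: field_simps power2_eq_square)
  qed
  show "((\<lambda>z. z powi (- int N) * X z $ 1 $ 1) \<longlongrightarrow> 1) at_infinity"
    by (rule Lim_transform_eventually[OF E_inverse[of 1 1]])
      (use entries in eventually_elim, simp add: power_int_minus)
  show "((\<lambda>z. z powi int N * X z $ 2 $ 2) \<longlongrightarrow> 1) at_infinity"
    by (rule Lim_transform_eventually[OF E_inverse[of 2 2]])
      (use entries in eventually_elim, simp add: power_int_minus)
  have "((\<lambda>z. z powi (1 - int N) * X z $ 2 $ 1) \<longlongrightarrow> X1 $ 2 $ 1) at_infinity"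
    by (rule Lim_transform_eventually[OF E])
      (use entries in eventually_elim, simp add: power_int_diff)
  then show "\<exists>L. ((\<lambda>z. z powi (1 - int N) * X z $ 2 $ 1) \<longlongrightarrow> L) at_infinity" ..
  have "((\<lambda>z. z powi (1 + int N) * X z $ 1 $ 2) \<longlongrightarrow> X1 $ 1 $ 2) at_infinity"
    by (rule Lim_transform_eventually[OF E])
      (use entries in eventually_elim, simp add: power_int_add power_int_minus field_simps)
  then show "\<exists>L. ((\<lambda>z. z powi (1 + int N) * X z $ 1 $ 2) \<longlongrightarrow> L) at_infinity" ..
qed

section \<open>Schur complement of the Toeplitz block\<close>

lemma semi_framed_det_Schur_complement:
  assumes S: "\<And>i l. i \<le> n \<Longrightarrow> l \<le> n \<Longrightarrow>
      (\<Sum>k\<le>n. fourier_coeff \<phi> (int i - int k) * S k l) = (if i = l then 1 else 0)"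
  shows "semi_framed_det (n + 2) \<phi> c r a =
      toeplitz_det \<phi> (n + 1) * (a - (\<Sum>k\<le>n. \<Sum>l\<le>n. r k * S k l * c l))"
proof -
  let ?m = "Suc n"
  define T where "T = Matrix.mat ?m ?m (\<lambda>(j, k). fourier_coeff \<phi> (int j - int k))"
  define C where "C = Matrix.mat ?m 1 (\<lambda>(j, k). c j)"
  define R where "R = Matrix.mat 1 ?m (\<lambda>(j, k). r k)"
  define A where "A = Matrix.mat 1 1 (\<lambda>(j :: nat, k :: nat). a)"
  define s where "s k = (\<Sum>l\<le>n. S k l * c l)" for k
  \<comment> \<open>The vector \<open>s\<close> solves the Toeplitz system with right-hand side
    \<open>c\<close>. Multiplying from the right by the unipotent block matrix with corner
    \<open>V\<close> therefore clears the last column and keeps the determinant.\<close>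
  define V where "V = Matrix.mat ?m 1 (\<lambda>(k, j :: nat). - s k)"
  have carrier: "T \<in> carrier_mat ?m ?m" "C \<in> carrier_mat ?m 1" "R \<in> carrier_mat 1 ?m"
      "A \<in> carrier_mat 1 1" "V \<in> carrier_mat ?m 1"
    by (auto simp: T_def C_def R_def A_def V_def)
  have Ts: "(\<Sum>k\<le>n. fourier_coeff \<phi> (int i - int k) * s k) = c i" if "i \<le> n" for i
  proof -
    have "(\<Sum>k\<le>n. fourier_coeff \<phi> (int i - int k) * s k) =
        (\<Sum>l\<le>n. (\<Sum>k\<le>n. fourier_coeff \<phi> (int i - int k) * S k l) * c l)"
      unfolding s_def sum_distrib_left sum_distrib_right by (subst sum.swap) (simp add: mult_ac)
    also have "\<dots> = (\<Sum>l\<le>n. if i = l then c l else 0)"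
      using that by (intro sum.cong) (auto simp: S)
    finally show ?thesis
      using that by simp
  qed
  have "T * V + C = 0\<^sub>m ?m 1"
    by (rule eq_matI) (auto simp: T_def V_def C_def scalar_prod_def atLeast0LessThan lessThan_Suc_atMost sum_negf Ts
      simp del: sum.atMost_Suc)
  moreover have "R * V + A = Matrix.mat 1 1 (\<lambda>_. a - (\<Sum>k\<le>n. r k * s k))"
    by (rule eq_matI) (auto simp: R_def V_def A_def scalar_prod_def atLeast0LessThan lessThan_Suc_atMost sum_negf
      simp del: sum.atMost_Suc)
  ultimately have "four_block_mat T C R A * four_block_mat (1\<^sub>m ?m) V (0\<^sub>m 1 ?m) (1\<^sub>m 1) =
      four_block_mat T (0\<^sub>m ?m 1) R (Matrix.mat 1 1 (\<lambda>_. a - (\<Sum>k\<le>n. r k * s k)))"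
    using carrier
    by (subst mult_four_block_mat[of _ ?m ?m _ 1 _ 1]) (auto simp: right_mult_zero_mat)
  moreover have "Determinant.det (four_block_mat T C R A * four_block_mat (1\<^sub>m ?m) V (0\<^sub>m 1 ?m) (1\<^sub>m 1)) =
      Determinant.det (four_block_mat T C R A) * Determinant.det (four_block_mat (1\<^sub>m ?m) V (0\<^sub>m 1 ?m) (1\<^sub>m 1))"
    using carrier by (intro det_mult[where n = "?m + 1"] four_block_carrier_mat) auto
  moreover have "Determinant.det (four_block_mat (1\<^sub>m ?m) V (0\<^sub>m 1 ?m) (1\<^sub>m 1)) = 1"
    using carrier by (subst det_four_block_mat_lower_left_zero[where n = ?m and m = 1]) auto
  moreover have "Determinant.det (four_block_mat T (0\<^sub>m ?m 1) R (Matrix.mat 1 1 (\<lambda>_. a - (\<Sum>k\<le>n. r k * s k)))) =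
      Determinant.det T * (a - (\<Sum>k\<le>n. r k * s k))"
    using carrier by (subst det_four_block_mat_upper_right_zero[where n = ?m and m = 1]) (auto simp: det_single)
  moreover have "semi_framed_det (n + 2) \<phi> c r a = Determinant.det (four_block_mat T C R A)"
    unfolding semi_framed_det_def
    by (intro arg_cong[where f = Determinant.det] eq_matI)
      (auto simp: T_def C_def R_def A_def less_Suc_eq)
  ultimately show ?thesis
    by (simp add: toeplitz_det_def T_def s_def sum_distrib_left mult_ac)
qed

section \<open>From the Riemann--Hilbert problem to polynomials and Toeplitz systems\<close>

text \<open>The two boundary values of the first column agree almost everywhere. The inside forbids
  negative Fourier indices and the outside those above \<open>M\<close>, which leaves a polynomial.
  Fourier coefficients of the jump in the second column then give linear equations for its
  coefficients.\<close>

lemma X_RHP_first_column: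
  fixes X :: "complex \<Rightarrow> complex^2^2" and i :: 2
  assumes X: "X_RHP \<phi> N X" and \<phi>: "L1_circle \<phi>"
    and lim1: "((\<lambda>z. z powi (- int M) * X z $ i $ 1) \<longlongrightarrow> L1) at_infinity"
    and lim2: "((\<lambda>z. z powi m * X z $ i $ 2) \<longlongrightarrow> L2) at_infinity"
  obtains d where "d M = L1" and "\<And>k. k > M \<Longrightarrow> d k = 0"
    and "\<And>z. z \<in> sphere 0 1 \<Longrightarrow> first_column X i z = (\<Sum>k\<le>M. d k * z ^ k)"
    and "\<And>j. j < N \<Longrightarrow> int j \<ge> int N - m \<Longrightarrow>
      (\<Sum>k\<le>M. fourier_coeff \<phi> (int j - int k) * d k) = (if int j = int N - m then - L2 else 0)"
proof -
  obtain Xp Xm where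
    an: "(\<lambda>z. X z $ i $ l) analytic_on (- sphere 0 1)"
    and lim_p: "\<And>z. z \<in> sphere 0 1 \<Longrightarrow> (X \<longlongrightarrow> Xp z) (at z within ball 0 1)"
    and lim_m: "\<And>z. z \<in> sphere 0 1 \<Longrightarrow> (X \<longlongrightarrow> Xm z) (at z within - cball 0 1)"
    and cont_p: "continuous_on (sphere 0 1) Xp" and cont_m: "continuous_on (sphere 0 1) Xm"
    and jump: "AE t in lebesgue_on {0..1}.
           let z = circlepath 0 1 t in Xp z = Xm z ** RHP_jump \<phi> N z" for l
    using X unfolding X_RHP_def by blast
  have hol_p: "(\<lambda>z. X z $ i $ l) holomorphic_on ball 0 1" for l
    by (rule analytic_imp_holomorphic[OF analytic_on_subset[OF an]]) auto
  have hol_m: "(\<lambda>z. X z $ i $ l) holomorphic_on - cball 0 1" for l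
    by (rule analytic_imp_holomorphic[OF analytic_on_subset[OF an]]) auto
  note cont_p' = continuous_on_component[OF continuous_on_component[OF cont_p]]
  note cont_m' = continuous_on_component[OF continuous_on_component[OF cont_m]]
  have lim_p': "((\<lambda>z. X z $ i $ l) \<longlongrightarrow> Xp z $ i $ l) (at z within ball 0 1)" if "z \<in> sphere 0 1" for z l
    using lim_p[OF that] by (intro tendsto_vec_nth)
  have lim_m': "((\<lambda>z. X z $ i $ l) \<longlongrightarrow> Xm z $ i $ l) (at z within - cball 0 1)" if "z \<in> sphere 0 1" for z l
    using lim_m[OF that] by (intro tendsto_vec_nth)
  define F where "F l z = (if z \<in> ball 0 1 then X z $ i $ l else Xp z $ i $ l)" for l z
  have cont_F: "continuous_on (cball 0 1) (F l)" for l
    unfolding F_def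
    by (rule continuous_on_cball_boundary_values[OF holomorphic_on_imp_continuous_on[OF hol_p] cont_p' lim_p'])
  have hol_F: "F l holomorphic_on ball 0 1" for l
    by (rule holomorphic_transform[OF hol_p]) (simp add: F_def)
  have F_coeff: "fourier_coeff (F l) k = fourier_coeff (\<lambda>z. Xp z $ i $ l) k" for l k
    unfolding fourier_coeff_def by (rule circle_integral_cong) (simp add: F_def)
  define d where "d k = fourier_coeff (\<lambda>z. Xp z $ i $ 1) (int k)" for k

  have "AE t in lebesgue_on {0..1}. Xp (circlepath 0 1 t) $ i $ 1 = Xm (circlepath 0 1 t) $ i $ 1"
    using jump
    by eventually_elim (simp add: Let_def RHP_jump_def matrix_matrix_mult_def sum_2)
  then have d_exterior: "d k = fourier_coeff (\<lambda>z. Xm z $ i $ 1) (int k)" for k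
    unfolding d_def by (rule fourier_coeff_cong_AE)
  note exterior1 = fourier_coeff_exterior[OF hol_m cont_m' lim_m' lim1]
  have d_M: "d M = L1"
    using exterior1(1) by (simp add: d_exterior)
  have d_0: "d k = 0" if "k > M" for k
    using exterior1(2)[of "int k"] that by (simp add: d_exterior)
  have poly: "Xp z $ i $ 1 = (\<Sum>k\<le>M. d k * z ^ k)" if "z \<in> sphere 0 1" for z
    using disc_function_eq_polynomial[OF cont_F hol_F, of M 1 z] that d_0
    by (simp add: F_coeff d_def) (simp add: F_def)

  \<comment> \<open>The additive jump of the second column, with the polynomial inserted for the
    first.\<close>
  have "AE t in lebesgue_on {0..1}.
      Xp (circlepath 0 1 t) $ i $ 2 - Xm (circlepath 0 1 t) $ i $ 2 =
      circlepath 0 1 t powi (- int N) * (\<Sum>k\<le>M. d k * (circlepath 0 1 t powi int k * \<phi> (circlepath 0 1 t)))"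
    using jump
  proof eventually_elim
    case (elim t)
    then have e: "Xp (circlepath 0 1 t) = Xm (circlepath 0 1 t) ** RHP_jump \<phi> N (circlepath 0 1 t)"
      by (simp add: Let_def)
    then have "Xm (circlepath 0 1 t) $ i $ 1 = (\<Sum>k\<le>M. d k * circlepath 0 1 t ^ k)"
      using poly[OF circlepath_in_sphere, of t]
      by (simp add: RHP_jump_def matrix_matrix_mult_def sum_2)
    moreover from e have "Xp (circlepath 0 1 t) $ i $ 2 - Xm (circlepath 0 1 t) $ i $ 2 =
        circlepath 0 1 t powi (- int N) * \<phi> (circlepath 0 1 t) * Xm (circlepath 0 1 t) $ i $ 1"
      by (simp add: RHP_jump_def matrix_matrix_mult_def sum_2)
    ultimately show ?case
      by (simp add: sum_distrib_left mult_ac)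
  qed
  note jump2 = fourier_coeff_cong_AE[OF this]
  note exterior2 = fourier_coeff_exterior[OF hol_m cont_m' lim_m' lim2]
  have "(\<Sum>k\<le>M. fourier_coeff \<phi> (int j - int k) * d k) = (if int j = int N - m then - L2 else 0)"
    if "j < N" "int j \<ge> int N - m" for j
  proof -
    \<comment> \<open>The factor \<open>z powi (- int N)\<close> shifts the index to
      \<open>int j - int N\<close>. This is negative, so the inner boundary value contributes
      nothing; the outer one contributes \<open>L2\<close> at index \<open>- m\<close> and 0 above
      it.\<close>
    have "(\<Sum>k\<le>M. fourier_coeff \<phi> (int j - int k) * d k) =
        fourier_coeff (\<lambda>z. z powi (- int N) * (\<Sum>k\<le>M. d k * (z powi int k * \<phi> z))) (int j - int N)"
      unfolding fourier_coeff_shift fourier_coeff_sum_powers[OF \<phi>] by (simp add: mult.commute)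
    also have "\<dots> = fourier_coeff (\<lambda>z. Xp z $ i $ 2 - Xm z $ i $ 2) (int j - int N)"
      by (rule jump2[symmetric])
    also have "\<dots> = fourier_coeff (F 2) (int j - int N) - fourier_coeff (\<lambda>z. Xm z $ i $ 2) (int j - int N)"
      unfolding F_coeff by (intro fourier_coeff_diff L1_circle_continuous cont_p' cont_m')
    also have "fourier_coeff (F 2) (int j - int N) = 0"
      using \<open>j < N\<close> by (intro fourier_coeff_disc_negative[OF cont_F hol_F]) simp
    also have "fourier_coeff (\<lambda>z. Xm z $ i $ 2) (int j - int N) = (if int j = int N - m then L2 else 0)"
    proof (cases "int j = int N - m")
      case True
      then show ?thesis
        using exterior2(1) by simp
    next
      case False
      then show ?thesis
        using exterior2(2)[of "int j - int N"] that by simp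
    qed
    finally show ?thesis
      by simp
  qed
  moreover have "first_column X i z = (\<Sum>k\<le>M. d k * z ^ k)" if z: "z \<in> sphere 0 1" for z
  proof -
    \<comment> \<open>Ensures that the filter is nontrivial, so that \<open>Lim\<close> denotes the
      actual boundary value.\<close>
    have "z islimpt ball 0 1"
      using z by (simp add: islimpt_ball)
    then have "Lim (at z within ball 0 1) (\<lambda>w. X w $ i $ 1) = Xp z $ i $ 1"
      by (intro tendsto_Lim lim_p' z) (simp add: trivial_limit_within)
    then show ?thesis
      using z by (simp add: first_column_def poly)
  qed
  moreover note d_M d_0
  ultimately show ?thesis
    using that by blast
qed

section \<open>The double integrals and the four determinant formulas\<close>

lemma circle_double_integral_polynomial_kernel:
  fixes p :: "nat \<Rightarrow> nat \<Rightarrow> complex"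
  assumes f: "L1_circle f" and g: "L1_circle g"
    and D: "\<And>x y. x \<in> sphere 0 1 \<Longrightarrow> y \<in> sphere 0 1 \<Longrightarrow>
      D x y = (x - y) * (\<Sum>j\<le>n. \<Sum>k\<le>n. p j k * x ^ j * y ^ k)"
  shows "circle_integral (\<lambda>x. circle_integral (\<lambda>y. f x * g y / (x - y) * D x y)) =
      (\<Sum>j\<le>n. \<Sum>k\<le>n. p j k * fourier_coeff f (- int j) * fourier_coeff g (- int k))"
proof -
  have inner: "circle_integral (\<lambda>y. f x * g y / (x - y) * D x y) =
      (\<Sum>j\<le>n. (\<Sum>k\<le>n. p j k * fourier_coeff g (- int k)) * (x powi int j * f x))"
    if x: "x \<in> sphere 0 1" for x
  proof -
    have "circle_integral (\<lambda>y. f x * g y / (x - y) * D x y) =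
        circle_integral (\<lambda>y. \<Sum>k\<le>n. (f x * (\<Sum>j\<le>n. p j k * x ^ j)) * (y powi int k * g y))"
    \<comment> \<open>Off the diagonal the factor \<open>x - y\<close> cancels, and the kernel
      becomes a polynomial whose monomials integrate to Fourier coefficients.\<close>
    proof (rule circle_integral_cong_except)
      fix y assume "y \<in> sphere 0 1" "y \<noteq> x"
      then have "f x * g y / (x - y) * D x y = f x * g y * (\<Sum>j\<le>n. \<Sum>k\<le>n. p j k * x ^ j * y ^ k)"
        by (simp add: D[OF x])
      also have "\<dots> = (\<Sum>k\<le>n. (f x * (\<Sum>j\<le>n. p j k * x ^ j)) * (y powi int k * g y))"
        by (subst sum.swap) (simp add: sum_distrib_left sum_distrib_right mult_ac)
      finally show "f x * g y / (x - y) * D x y = \<dots>" .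
    qed
    also have "\<dots> = (\<Sum>k\<le>n. (f x * (\<Sum>j\<le>n. p j k * x ^ j)) * fourier_coeff g (- int k))"
      by (rule circle_integral_sum_powers[OF g])
    also have "\<dots> = (\<Sum>j\<le>n. (\<Sum>k\<le>n. p j k * fourier_coeff g (- int k)) * (x powi int j * f x))"
      by (simp add: sum_distrib_left sum_distrib_right mult_ac) (rule sum.swap)
    finally show ?thesis .
  qed
  have "circle_integral (\<lambda>x. circle_integral (\<lambda>y. f x * g y / (x - y) * D x y)) =
      circle_integral (\<lambda>x. \<Sum>j\<le>n. (\<Sum>k\<le>n. p j k * fourier_coeff g (- int k)) * (x powi int j * f x))"
    by (rule circle_integral_cong) (rule inner)
  also have "\<dots> = (\<Sum>j\<le>n. (\<Sum>k\<le>n. p j k * fourier_coeff g (- int k)) * fourier_coeff f (- int j))"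
    by (rule circle_integral_sum_powers[OF f])
  finally show ?thesis
    by (simp add: sum_distrib_left sum_distrib_right mult_ac)
qed

lemma Delta_eq_bezoutian:
  fixes X Y :: "complex \<Rightarrow> complex^2^2"
  assumes \<phi>: "L1_circle \<phi>" and X: "X_RHP \<phi> (n + 1) X" and Y: "X_RHP \<phi> (n + 2) Y"
  obtains p where
    "\<And>z1 z2. z1 \<in> sphere 0 1 \<Longrightarrow> z2 \<in> sphere 0 1 \<Longrightarrow>
      Delta X Y z1 z2 = (z1 - z2) * (\<Sum>j\<le>n. \<Sum>k\<le>n. p j k * z1 ^ j * z2 ^ k)"
    "\<And>i j. i \<le> n \<Longrightarrow> j \<le> n \<Longrightarrow>
      (\<Sum>k\<le>n. fourier_coeff \<phi> (int i - int k) * p j k) = (if i + j = n then 1 else 0)"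
proof -
  \<comment> \<open>Row 1 with \<open>N = n + 1\<close> and \<open>m = n + 2\<close>: the
    exceptional index \<open>N - m\<close> is -1, so the equations for \<open>d\<close> are
    homogeneous whatever the value of \<open>L\<close>.\<close>
  obtain L where L: "((\<lambda>z. z powi (1 + int (n + 1)) * X z $ 1 $ 2) \<longlongrightarrow> L) at_infinity"
    using X_RHP_asymptotics(3)[OF X] by blast
  obtain d where d: "d (n + 1) = 1" "\<And>k. k > n + 1 \<Longrightarrow> d k = 0"
      "\<And>z. z \<in> sphere 0 1 \<Longrightarrow> first_column X 1 z = (\<Sum>k\<le>n + 1. d k * z ^ k)"
    and d_eq: "\<And>j. j < n + 1 \<Longrightarrow> int j \<ge> int (n + 1) - (1 + int (n + 1)) \<Longrightarrow>
      (\<Sum>k\<le>n + 1. fourier_coeff \<phi> (int j - int k) * d k) =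
      (if int j = int (n + 1) - (1 + int (n + 1)) then - L else 0)"
    using X_RHP_first_column[OF X \<phi> X_RHP_asymptotics(1)[OF X] L] by blast
  obtain L' where "((\<lambda>z. z powi (1 - int (n + 2)) * Y z $ 2 $ 1) \<longlongrightarrow> L') at_infinity"
    using X_RHP_asymptotics(2)[OF Y] by blast
  then have L': "((\<lambda>z. z powi (- int (n + 1)) * Y z $ 2 $ 1) \<longlongrightarrow> L') at_infinity"
    by simp
  \<comment> \<open>Row 2 with \<open>N = m = n + 2\<close>: the exceptional index is 0, and the
    normalisation of the 22 entry yields the right-hand side -1 there.\<close>
  obtain c where c: "\<And>k. k > n + 1 \<Longrightarrow> c k = 0"
      "\<And>z. z \<in> sphere 0 1 \<Longrightarrow> first_column Y 2 z = (\<Sum>k\<le>n + 1. c k * z ^ k)"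
    and c_eq: "\<And>j. j < n + 2 \<Longrightarrow> int j \<ge> int (n + 2) - int (n + 2) \<Longrightarrow>
      (\<Sum>k\<le>n + 1. fourier_coeff \<phi> (int j - int k) * c k) =
      (if int j = int (n + 2) - int (n + 2) then - 1 else 0)"
    using X_RHP_first_column[OF Y \<phi> L' X_RHP_asymptotics(4)[OF Y]] by blast
  show ?thesis
  proof
    fix z1 z2 :: complex assume z: "z1 \<in> sphere 0 1" "z2 \<in> sphere 0 1"
    show "Delta X Y z1 z2 = (z1 - z2) * (\<Sum>j\<le>n. \<Sum>k\<le>n. bezout_coeff c d j k * z1 ^ j * z2 ^ k)"
      unfolding Delta_def det_2 using bezoutian_expansion[of n c d z1 z2] c(1) d(2)
      by (simp add: c(2)[OF z(1)] c(2)[OF z(2)] d(3)[OF z(1)] d(3)[OF z(2)] mult.commute del: sum.atMost_Suc)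
  next
    fix i j assume "i \<le> n" "j \<le> n"
    then show "(\<Sum>k\<le>n. fourier_coeff \<phi> (int i - int k) * bezout_coeff c d j k) = (if i + j = n then 1 else 0)"
      using c(1) d(1,2) c_eq d_eq by (intro bezoutian_toeplitz_inverse) simp_all
  qed
qed

theorem corollary1p14:
  fixes \<phi> \<psi> \<eta> :: "complex \<Rightarrow> complex" and a :: complex and n :: nat
    and X :: "nat \<Rightarrow> complex \<Rightarrow> complex^2^2"
  assumes "L1_circle \<phi>" and "L1_circle \<psi>" and "L1_circle \<eta>"
    and "\<forall>k \<le> n + 1. toeplitz_det \<phi> k \<noteq> 0"
    and "X_RHP \<phi> (n + 1) (X (n + 1))"
    and "X_RHP \<phi> (n + 2) (X (n + 2))"
  shows
    "E_det (n + 2) \<phi> \<psi> \<eta> a / toeplitz_det \<phi> (n + 1) =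
        a - circle_integral (\<lambda>z1. circle_integral (\<lambda>z2.
              z2 powi (- int n) * \<eta> z2 * reflect \<psi> z1 / (z1 - z2) * Delta (X (n + 1)) (X (n + 2)) z1 z2))
     \<and>
     G_det (n + 2) \<phi> \<psi> \<eta> a / toeplitz_det \<phi> (n + 1) =
        a - circle_integral (\<lambda>z1. circle_integral (\<lambda>z2.
              z1 powi (- int n) * reflect \<eta> z2 * \<psi> z1 / (z1 - z2) * Delta (X (n + 1)) (X (n + 2)) z1 z2))
     \<and>
     H_det (n + 2) \<phi> \<psi> \<eta> a / toeplitz_det \<phi> (n + 1) =
        a - circle_integral (\<lambda>z1. circle_integral (\<lambda>z2.
              z1 powi (- int n) * z2 powi (- int n) * \<eta> z2 * \<psi> z1 / (z1 - z2) * Delta (X (n + 1)) (X (n + 2)) z1 z2))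
     \<and>
     L_det (n + 2) \<phi> \<psi> \<eta> a / toeplitz_det \<phi> (n + 1) =
        a - circle_integral (\<lambda>z1. circle_integral (\<lambda>z2.
              reflect \<eta> z2 * reflect \<psi> z1 / (z1 - z2) * Delta (X (n + 1)) (X (n + 2)) z1 z2))"
proof -
  let ?D = "Delta (X (n + 1)) (X (n + 2))"
  obtain p where D: "\<And>z1 z2. z1 \<in> sphere 0 1 \<Longrightarrow> z2 \<in> sphere 0 1 \<Longrightarrow>
      ?D z1 z2 = (z1 - z2) * (\<Sum>j\<le>n. \<Sum>k\<le>n. p j k * z1 ^ j * z2 ^ k)"
    and p: "\<And>i j. i \<le> n \<Longrightarrow> j \<le> n \<Longrightarrow>
      (\<Sum>k\<le>n. fourier_coeff \<phi> (int i - int k) * p j k) = (if i + j = n then 1 else 0)"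
    using Delta_eq_bezoutian[OF assms(1,5,6)] by blast
  \<comment> \<open>All four formulas are one statement about weights \<open>f\<close> and
    \<open>g\<close>. The reversal \<open>c (n - j)\<close> matches the Bezoutian, whose product
    with the Toeplitz matrix is the antidiagonal identity; hence \<open>p (n - l) k\<close> is the
    entry of the inverse in row \<open>k\<close> and column \<open>l\<close>.\<close>
  have main: "semi_framed_det (n + 2) \<phi> c r a / toeplitz_det \<phi> (n + 1) =
      a - circle_integral (\<lambda>z1. circle_integral (\<lambda>z2. f z1 * g z2 / (z1 - z2) * ?D z1 z2))"
    if "L1_circle f" "L1_circle g"
      and c: "\<And>j. j \<le> n \<Longrightarrow> fourier_coeff f (- int j) = c (n - j)"
      and r: "\<And>k. k \<le> n \<Longrightarrow> fourier_coeff g (- int k) = r k" for f g c r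
  proof -
    have "circle_integral (\<lambda>z1. circle_integral (\<lambda>z2. f z1 * g z2 / (z1 - z2) * ?D z1 z2)) =
        (\<Sum>j\<le>n. \<Sum>k\<le>n. p j k * fourier_coeff f (- int j) * fourier_coeff g (- int k))"
      using that(1,2) D by (rule circle_double_integral_polynomial_kernel)
    also have "\<dots> = (\<Sum>j\<le>n. \<Sum>k\<le>n. p j k * c (n - j) * r k)"
      by (intro sum.cong refl) (simp add: c r)
    also have "\<dots> = (\<Sum>l\<le>n. \<Sum>k\<le>n. r k * p (n - l) k * c l)"
      by (rule sum.reindex_bij_witness[of _ "\<lambda>j. n - j" "\<lambda>j. n - j"]) (auto simp: mult_ac)
    also have "\<dots> = (\<Sum>k\<le>n. \<Sum>l\<le>n. r k * p (n - l) k * c l)"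
      by (rule sum.swap)
    finally have integral: "circle_integral (\<lambda>z1. circle_integral (\<lambda>z2. f z1 * g z2 / (z1 - z2) * ?D z1 z2)) =
        (\<Sum>k\<le>n. \<Sum>l\<le>n. r k * p (n - l) k * c l)" .
    have "semi_framed_det (n + 2) \<phi> c r a =
        toeplitz_det \<phi> (n + 1) * (a - (\<Sum>k\<le>n. \<Sum>l\<le>n. r k * p (n - l) k * c l))"
      by (rule semi_framed_det_Schur_complement) (auto simp: p)
    moreover have "toeplitz_det \<phi> (n + 1) \<noteq> 0"
      using assms(4) by blast
    ultimately show ?thesis
      unfolding integral by (simp only: nonzero_mult_div_cancel_left not_False_eq_True)
  qed
  have f1: "L1_circle (\<lambda>z. z powi (- int n) * f z)" "L1_circle (reflect f)" if "L1_circle f" for f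
    using that by (intro L1_circle_power L1_circle_reflect; assumption)+
  \<comment> \<open>Column data indexed by \<open>n - j\<close> correspond to the weight
    \<open>reflect \<psi>\<close>, and data indexed by \<open>j\<close> to \<psi> times
    \<open>z powi (- int n)\<close>. For the row data in \<eta>, without the reversal, the two
    choices are interchanged.\<close>
  note simps = fourier_coeff_shift fourier_coeff_reflect of_nat_diff
  have E: "E_det (n + 2) \<phi> \<psi> \<eta> a / toeplitz_det \<phi> (n + 1) =
      a - circle_integral (\<lambda>z1. circle_integral (\<lambda>z2.
        reflect \<psi> z1 * (z2 powi (- int n) * \<eta> z2) / (z1 - z2) * ?D z1 z2))"
    unfolding E_det_def by (rule main) (use assms f1 in \<open>simp_all add: simps\<close>)
  have G: "G_det (n + 2) \<phi> \<psi> \<eta> a / toeplitz_det \<phi> (n + 1) =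
      a - circle_integral (\<lambda>z1. circle_integral (\<lambda>z2.
        (z1 powi (- int n) * \<psi> z1) * reflect \<eta> z2 / (z1 - z2) * ?D z1 z2))"
    unfolding G_det_def by (rule main) (use assms f1 in \<open>simp_all add: simps\<close>)
  have H: "H_det (n + 2) \<phi> \<psi> \<eta> a / toeplitz_det \<phi> (n + 1) =
      a - circle_integral (\<lambda>z1. circle_integral (\<lambda>z2.
        (z1 powi (- int n) * \<psi> z1) * (z2 powi (- int n) * \<eta> z2) / (z1 - z2) * ?D z1 z2))"
    unfolding H_det_def by (rule main) (use assms f1 in \<open>simp_all add: simps\<close>)
  have L: "L_det (n + 2) \<phi> \<psi> \<eta> a / toeplitz_det \<phi> (n + 1) =
      a - circle_integral (\<lambda>z1. circle_integral (\<lambda>z2.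
        reflect \<psi> z1 * reflect \<eta> z2 / (z1 - z2) * ?D z1 z2))"
    unfolding L_det_def by (rule main) (use assms f1 in \<open>simp_all add: simps\<close>)
  show ?thesis
    using E G H L by (simp add: mult_ac)
qed

end
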